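(* Assume conditions $(\Omega_1)$ and $(\Omega_2(\kappa))$ below hold. For $z>2$ and $\lambda>0$ we have $G(z)^{-1}\le W(z)\,m_3(z,\lambda)$, where \begin{align*} m_3(z,\lambda)&=1+2m_4^{\kappa}\exp\left(\frac{A_2}{\log 2}\left(1+A_1\kappa+\frac{A_1A_2}{\log 2}\right)+\frac{L}{\log 2}-\lambda+\left(\frac{2\kappa}{\lambda}+\frac{A_2}{\log z}\right)e^{\lambda}\right),\\ m_4&=2\kappa e+\frac{A_2e}{\log 2}+\log 2. \end{align*}
   Context: $p$ always denotes a prime and $\mu$ is the Möbius function. $\omega$ is a multiplicative function on squarefree positive integers. Define $W(z)=\prod_{p<z}\left(1-\frac{\omega(p)}{p}\right)$, $g(d)=\frac{\omega(d)}{d}\prod_{p\mid d}\left(1-\frac{\omega(p)}{p}\right)^{-1}$ for squarefree $d$, and $G(z)=\sum_{d<z}\mu^2(d)g(d)$. Constants $\kappa\ge1$, $A_1>1$, $A_2>0$ and $L$ are given. Condition $(\Omega_1)$: for every prime $p$, $0\le \omega(p)/p\le 1-1/A_1$. Condition $(\Omega_2(\kappa))$: for all $2\le w<z$, $-L\le \sum_{w\le p<z}\frac{\omega(p)\log p}{p}-\kappa\log\frac{z}{w}\le A_2$. *)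

theory Defs
  imports Complex_Main "HOL-Computational_Algebra.Squarefree"
begin

(* The values of f at arguments that are not squarefree are left unconstrained: m * n is
   squarefree when m and n are squarefree and coprime. *)
definition multiplicative_on_squarefree :: "(nat \<Rightarrow> real) \<Rightarrow> bool" where
  "multiplicative_on_squarefree f \<longleftrightarrow>
     f 1 = 1 \<and>
     (\<forall>m n. squarefree m \<longrightarrow> squarefree n \<longrightarrow> coprime m n \<longrightarrow> f (m * n) = f m * f n)"

(* moebius_mu 0 = 0, as 0 is not squarefree. *)
definition moebius_mu :: "nat \<Rightarrow> int" where
  "moebius_mu n = (if squarefree n then (- 1) ^ card (prime_factors n) else 0)"

definition sieve_W :: "(nat \<Rightarrow> real) \<Rightarrow> real \<Rightarrow> real" where
  "sieve_W \<omega> z = (\<Prod>p | prime p \<and> real p < z. 1 - \<omega> p / real p)"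

definition sieve_g :: "(nat \<Rightarrow> real) \<Rightarrow> nat \<Rightarrow> real" where
  "sieve_g \<omega> d = \<omega> d / real d * (\<Prod>p\<in>prime_factors d. inverse (1 - \<omega> p / real p))"

(* sieve_g is only meaningful at squarefree d; the other terms vanish with moebius_mu. *)
definition sieve_G :: "(nat \<Rightarrow> real) \<Rightarrow> real \<Rightarrow> real" where
  "sieve_G \<omega> z = (\<Sum>d | 1 \<le> d \<and> real d < z. (real_of_int (moebius_mu d))\<^sup>2 * sieve_g \<omega> d)"

definition Omega1 :: "(nat \<Rightarrow> real) \<Rightarrow> real \<Rightarrow> bool" where
  "Omega1 \<omega> A1 \<longleftrightarrow> (\<forall>p. prime p \<longrightarrow> 0 \<le> \<omega> p / real p \<and> \<omega> p / real p \<le> 1 - 1 / A1)"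

definition Omega2 :: "(nat \<Rightarrow> real) \<Rightarrow> real \<Rightarrow> real \<Rightarrow> real \<Rightarrow> bool" where
  "Omega2 \<omega> \<kappa> A2 L \<longleftrightarrow>
     (\<forall>w z :: real. 2 \<le> w \<longrightarrow> w < z \<longrightarrow>
        - L \<le> (\<Sum>p | prime p \<and> w \<le> real p \<and> real p < z. \<omega> p * ln (real p) / real p)
               - \<kappa> * ln (z / w) \<and>
        (\<Sum>p | prime p \<and> w \<le> real p \<and> real p < z. \<omega> p * ln (real p) / real p)
               - \<kappa> * ln (z / w) \<le> A2)"

definition m4 :: "real \<Rightarrow> real \<Rightarrow> real" where
  "m4 \<kappa> A2 = 2 * \<kappa> * exp 1 + A2 * exp 1 / ln 2 + ln 2"

definition m3 :: "real \<Rightarrow> real \<Rightarrow> real \<Rightarrow> real \<Rightarrow> real \<Rightarrow> real \<Rightarrow> real" where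
  "m3 \<kappa> A1 A2 L z lam =
     1 + 2 * m4 \<kappa> A2 powr \<kappa> *
       exp (A2 / ln 2 * (1 + A1 * \<kappa> + A1 * A2 / ln 2) + L / ln 2 - lam
            + (2 * \<kappa> / lam + A2 / ln z) * exp lam)"

end

theory Submission
  imports Defs "HOL-Analysis.Analysis"
begin

text \<open>
  Since the product of \<open>1 + g p\<close> over the primes \<open>p < w\<close> is \<open>1 / W(w)\<close>, the defect \<open>1 - G(z) W(w)\<close> is at
  most \<open>W(w)\<close> times the sum of \<open>g d\<close> over \<open>d \<ge> z\<close> composed of primes below \<open>w\<close>. Rankin's trick with
  exponent \<open>\<lambda> / ln w\<close> and partial summation bound it by
  \<open>exp (- \<lambda> ln z / ln w + (2\<kappa> / \<lambda> + A\<^sub>2 / ln w) exp \<lambda>)\<close>.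
  For \<open>w = z powr (1 / m\<^sub>4)\<close> and \<open>\<lambda> = 1\<close> this is at most \<open>1 / 2\<close>, so that \<open>1 / (G(z) W(z)) \<le> 2 W(w) / W(z)\<close>,
  and \<open>W(w) / W(z)\<close> is estimated by partial summation again. The theorem follows from
  \<open>1 / (G W) = 1 + (1 - G W) / (G W)\<close> with the defect bounded by the case \<open>w = z\<close>.
\<close>

section \<open>Partial summation against weights with controlled tail sums\<close>

text \<open>
  The majorant \<open>H'\<close> of \<open>h\<close> is allowed because \<open>(exp (\<epsilon> t) - 1) / t\<close> has no elementary
  antiderivative.
\<close>

lemma weighted_sum_le_increasing:
  fixes h h' H H' :: "real \<Rightarrow> real" and a x :: "'a \<Rightarrow> real"
  assumes "finite P" "U \<le> V" "0 \<le> \<kappa>"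
    and x: "\<And>p. p \<in> P \<Longrightarrow> x p \<in> {U..V}"
    and total: "sum a P \<le> \<kappa> * (V - U) + B"
    and upper: "\<And>t. t \<in> {U..V} \<Longrightarrow> sum a {p \<in> P. t < x p} \<le> \<kappa> * (V - t) + B"
    and h: "\<And>t. t \<in> {U..V} \<Longrightarrow> (h has_real_derivative h' t) (at t)"
    and H: "\<And>t. t \<in> {U..V} \<Longrightarrow> (H has_real_derivative H' t) (at t)"
    and h'_nonneg: "\<And>t. t \<in> {U..V} \<Longrightarrow> 0 \<le> h' t"
    and h_le: "\<And>t. t \<in> {U..V} \<Longrightarrow> h t \<le> H' t"
    and "0 \<le> h U"
  shows "(\<Sum>p\<in>P. a p * h (x p)) \<le> B * h V + \<kappa> * (H V - H U)"
proof -
  let ?F = "\<lambda>t. h t * (\<kappa> * (V - t) + B) + \<kappa> * H t"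
  \<comment> \<open>Writing \<open>h (x p) - h U\<close> as an integral of \<open>h'\<close> up to
    \<open>x p\<close> turns the sum over \<open>P\<close> into the integral of \<open>h' t\<close>
    against the tail sums in \<open>upper\<close>.\<close>
  have part: "((\<lambda>t. if t < x p then a p * h' t else 0) has_integral a p * (h (x p) - h U)) {U..V}"
    if "p \<in> P" for p
  proof -
    have "((\<lambda>t. a p * h' t) has_integral a p * h (x p) - a p * h U) {U..x p}"
    proof (rule fundamental_theorem_of_calculus[where f = "\<lambda>t. a p * h t"])
      fix t assume "t \<in> {U..x p}"
      then have "t \<in> {U..V}" using x[OF that] by auto
      then have "((\<lambda>t. a p * h t) has_real_derivative a p * h' t) (at t)"
        by (intro DERIV_cmult h)
      then show "((\<lambda>t. a p * h t) has_vector_derivative a p * h' t) (at t within {U..x p})"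
        unfolding has_real_derivative_iff_has_vector_derivative
        by (rule has_vector_derivative_at_within)
    qed (use x[OF that] in auto)
    then have "((\<lambda>t. if t \<in> {U..x p} then a p * h' t else 0) has_integral a p * (h (x p) - h U)) {U..V}"
      using x[OF that] by (subst has_integral_restrict) (auto simp: right_diff_distrib)
    then show ?thesis
      by (rule has_integral_spike_finite[of "{x p}", rotated 2]) auto
  qed
  have "((\<lambda>t. \<Sum>p\<in>P. if t < x p then a p * h' t else 0) has_integral
      (\<Sum>p\<in>P. a p * (h (x p) - h U))) {U..V}"
    by (rule has_integral_sum[where f = "\<lambda>p t. if t < x p then a p * h' t else 0",
          OF \<open>finite P\<close> part])
  \<comment> \<open>\<open>?F\<close> comes from integration by parts: its derivative is
    \<open>h'\<close> times the tail bound plus \<open>\<kappa>\<close> times the nonnegative gap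
    \<open>H' - h\<close>.\<close>
  moreover have "((\<lambda>t. h' t * (\<kappa> * (V - t) + B) + \<kappa> * (H' t - h t)) has_integral ?F V - ?F U) {U..V}"
  proof (rule fundamental_theorem_of_calculus[where f = ?F, OF \<open>U \<le> V\<close>])
    fix t assume t: "t \<in> {U..V}"
    have "(?F has_real_derivative h' t * (\<kappa> * (V - t) + B) + \<kappa> * (H' t - h t)) (at t)"
      by (rule derivative_eq_intros h[OF t] H[OF t] refl)+ (simp add: algebra_simps)
    then show "(?F has_vector_derivative h' t * (\<kappa> * (V - t) + B) + \<kappa> * (H' t - h t)) (at t within {U..V})"
      unfolding has_real_derivative_iff_has_vector_derivative
      by (rule has_vector_derivative_at_within)
  qed
  ultimately have "(\<Sum>p\<in>P. a p * (h (x p) - h U)) \<le> ?F V - ?F U"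
  proof (rule has_integral_le)
    fix t assume t: "t \<in> {U..V}"
    have "(\<Sum>p\<in>P. if t < x p then a p * h' t else 0) = h' t * sum a {p \<in> P. t < x p}"
      using \<open>finite P\<close> by (auto simp: sum.inter_filter sum_distrib_left intro!: sum.cong)
    also have "\<dots> \<le> h' t * (\<kappa> * (V - t) + B)"
      using upper h'_nonneg t by (simp add: mult_left_mono)
    also have "\<dots> \<le> h' t * (\<kappa> * (V - t) + B) + \<kappa> * (H' t - h t)"
      using h_le[OF t] \<open>0 \<le> \<kappa>\<close> by simp
    finally show "(\<Sum>p\<in>P. if t < x p then a p * h' t else 0) \<le>
        h' t * (\<kappa> * (V - t) + B) + \<kappa> * (H' t - h t)" .
  qed
  \<comment> \<open>The constant \<open>h U\<close> split off in \<open>part\<close> is paid for by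
    \<open>total\<close>, and the result cancels the corresponding term of
    \<open>?F U\<close>.\<close>
  moreover have "sum a P * h U \<le> (\<kappa> * (V - U) + B) * h U"
    using total \<open>0 \<le> h U\<close> by (rule mult_right_mono)
  moreover have "(\<Sum>p\<in>P. a p * (h (x p) - h U)) = (\<Sum>p\<in>P. a p * h (x p)) - sum a P * h U"
    by (simp add: right_diff_distrib sum_subtractf sum_distrib_right)
  ultimately show ?thesis
    by (simp add: algebra_simps)
qed

text \<open>The reflection \<open>t \<mapsto> - t\<close> turns initial segments into tails and a
  decreasing \<open>h\<close> into an increasing one. The weights used later, \<open>1 / t\<close>
  and \<open>1 / t\<^sup>2\<close>, have elementary antiderivatives, so \<open>H\<close> is exact
  here.\<close>

lemma weighted_sum_le_decreasing:
  fixes h h' H :: "real \<Rightarrow> real" and a x :: "'a \<Rightarrow> real"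
  assumes "finite P" "U \<le> V" "0 \<le> \<kappa>"
    and x: "\<And>p. p \<in> P \<Longrightarrow> x p \<in> {U..V}"
    and total: "sum a P \<le> \<kappa> * (V - U) + B"
    and lower: "\<And>t. t \<in> {U..V} \<Longrightarrow> sum a {p \<in> P. x p < t} \<le> \<kappa> * (t - U) + B"
    and h: "\<And>t. t \<in> {U..V} \<Longrightarrow> (h has_real_derivative h' t) (at t)"
    and H: "\<And>t. t \<in> {U..V} \<Longrightarrow> (H has_real_derivative h t) (at t)"
    and h'_nonpos: "\<And>t. t \<in> {U..V} \<Longrightarrow> h' t \<le> 0"
    and "0 \<le> h V"
  shows "(\<Sum>p\<in>P. a p * h (x p)) \<le> B * h U + \<kappa> * (H V - H U)"
proof -
  \<comment> \<open>The double negations match the increasing case for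
    \<open>\<lambda>t. h (- t)\<close> at the points \<open>- x p\<close>, with the endpoints
    swapped.\<close>
  have "(\<Sum>p\<in>P. a p * h (- (- x p))) \<le> B * h (- (- U)) + \<kappa> * (- H (- (- U)) - - H (- (- V)))"
  proof (rule weighted_sum_le_increasing[where h = "\<lambda>t. h (- t)" and H = "\<lambda>t. - H (- t)"
        and h' = "\<lambda>t. - h' (- t)" and H' = "\<lambda>t. h (- t)" and x = "\<lambda>p. - x p" and U = "- V" and V = "- U"])
    fix t assume t: "t \<in> {- V..- U}"
    then have "- t \<in> {U..V}" by auto
    note t' = this h[OF this] H[OF this] h'_nonpos[OF this]
    show "((\<lambda>t. h (- t)) has_real_derivative - h' (- t)) (at t)"
      using DERIV_chain2[of h _ uminus t "-1" UNIV] t' by (simp add: DERIV_minus)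
    show "((\<lambda>t. - H (- t)) has_real_derivative h (- t)) (at t)"
      using DERIV_minus[OF DERIV_chain2[of H _ uminus t "-1" UNIV]] t' by (simp add: DERIV_minus)
    show "0 \<le> - h' (- t)" using t' by simp
    have "{p \<in> P. t < - x p} = {p \<in> P. x p < - t}" by auto
    then show "sum a {p \<in> P. t < - x p} \<le> \<kappa> * (- U - t) + B"
      using lower[OF t'(1)] by (simp add: algebra_simps)
  qed (use assms in auto)
  then show ?thesis by simp
qed

section \<open>Sets of primes, squarefree numbers and the sum \<open>G\<close>\<close>

lemma finite_primes_below: "finite {p::nat. prime p \<and> real p < z}"
  by (rule finite_subset[of _ "{..nat \<lceil>z\<rceil>}"]) (auto, linarith)

lemma prime_factors_prod_primes:
  fixes A :: "nat set"
  assumes "finite A" "\<And>p. p \<in> A \<Longrightarrow> prime p"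
  shows "prime_factors (\<Prod>A) = A"
  using assms
proof (induction A rule: finite_induct)
  case (insert q A)
  then have "\<Prod>A \<noteq> 0" "q \<noteq> 0" by (auto dest: prime_gt_0_nat)
  with insert show ?case by (simp add: prime_factors_product prime_prime_factors)
qed simp

lemma squarefree_prod_primes:
  fixes A :: "nat set"
  assumes "\<And>p. p \<in> A \<Longrightarrow> prime p"
  shows "squarefree (\<Prod>A)"
  by (rule squarefree_prod_coprime) (auto intro: primes_coprime squarefree_prime assms)

lemma prod_prime_factors_squarefree:
  fixes d :: nat
  assumes "squarefree d"
  shows "\<Prod>(prime_factors d) = d"
proof -
  have "d \<noteq> 0" using assms by (intro notI) simp
  then have "(\<Prod>p\<in>prime_factors d. p) = (\<Prod>p\<in>prime_factors d. p ^ multiplicity p d)"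
    using assms by (intro prod.cong) (simp_all add: squarefree_factorial_semiring')
  with \<open>d \<noteq> 0\<close> show ?thesis by (simp add: prod_prime_factors)
qed

lemma multiplicative_prod_primes:
  assumes "multiplicative_on_squarefree f" "finite A" "\<And>p. p \<in> A \<Longrightarrow> prime p"
  shows "f (\<Prod>A) = (\<Prod>p\<in>A. f p)"
  using assms(2,3)
proof (induction A rule: finite_induct)
  case empty
  then show ?case using assms(1) by (simp add: multiplicative_on_squarefree_def)
next
  case (insert q A)
  then have "coprime q (\<Prod>A)"
    by (intro prod_coprime_right primes_coprime) auto
  with insert assms(1) show ?case
    by (simp add: multiplicative_on_squarefree_def squarefree_prime squarefree_prod_primes)
qed

lemma sieve_g_prod_primes:
  assumes "multiplicative_on_squarefree \<omega>" "finite A" "\<And>p. p \<in> A \<Longrightarrow> prime p"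
  shows "sieve_g \<omega> (\<Prod>A) = (\<Prod>p\<in>A. (\<omega> p / p) / (1 - \<omega> p / p))"
proof -
  have "sieve_g \<omega> (\<Prod>A) = (\<Prod>p\<in>A. \<omega> p) / (\<Prod>p\<in>A. real p) * (\<Prod>p\<in>A. inverse (1 - \<omega> p / p))"
    using assms by (simp add: sieve_g_def prime_factors_prod_primes multiplicative_prod_primes)
  also have "\<dots> = (\<Prod>p\<in>A. (\<omega> p / p) / (1 - \<omega> p / p))"
    unfolding prod_dividef[symmetric] prod.distrib[symmetric] by (simp only: divide_inverse)
  finally show ?thesis .
qed

text \<open>A finite set of primes corresponds to the squarefree number that is its product, so the
  left side is a part of the sum \<open>G\<close>, whose other terms are nonnegative.\<close>

lemma sieve_G_ge_sum_subsets:
  assumes mult: "multiplicative_on_squarefree \<omega>"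
    and x: "\<And>p. prime p \<Longrightarrow> 0 \<le> \<omega> p / real p \<and> \<omega> p / real p < 1"
    and "finite P" and P: "\<And>p. p \<in> P \<Longrightarrow> prime p"
  shows "(\<Sum>A | A \<subseteq> P \<and> real (\<Prod>A) < z. \<Prod>p\<in>A. (\<omega> p / p) / (1 - \<omega> p / p)) \<le> sieve_G \<omega> z"
    (is "sum ?\<gamma> ?S \<le> _")
proof -
  let ?D = "{d::nat. 1 \<le> d \<and> real d < z}"
  let ?F = "\<lambda>d. (real_of_int (moebius_mu d))\<^sup>2 * sieve_g \<omega> d"
  have sub: "finite A" "\<And>p. p \<in> A \<Longrightarrow> prime p" if "A \<in> ?S" for A
    using that \<open>finite P\<close> P by (auto intro: finite_subset)
  have inj: "inj_on \<Prod> ?S"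
    by (rule inj_on_inverseI[where g = prime_factors]) (rule prime_factors_prod_primes[OF sub])
  have "?\<gamma> A = ?F (\<Prod>A)" if "A \<in> ?S" for A
    using sub[OF that] mult
    by (simp add: sieve_g_prod_primes moebius_mu_def squarefree_prod_primes flip: power_mult)
  then have "sum ?\<gamma> ?S = sum ?F (\<Prod> ` ?S)"
    using inj by (simp add: sum.reindex)
  also have "\<dots> \<le> sum ?F ?D"
  proof (rule sum_mono2)
    show "finite ?D"
      by (rule finite_subset[of _ "{..nat \<lceil>z\<rceil>}"]) (auto, linarith)
    have "1 \<le> \<Prod>A" if "A \<in> ?S" for A
      using sub[OF that] by (auto simp: Suc_le_eq intro!: prod_pos dest: prime_gt_0_nat)
    then show "\<Prod> ` ?S \<subseteq> ?D" by auto
  next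
    fix d
    \<comment> \<open>At squarefree \<open>d\<close> the sign follows from the values of
      \<open>\<omega>\<close> at primes; at other \<open>d\<close> the factor
      \<open>moebius_mu d\<close> vanishes.\<close>
    have "0 \<le> sieve_g \<omega> d" if "squarefree d"
    proof -
      have "sieve_g \<omega> (\<Prod>(prime_factors d)) = (\<Prod>p\<in>prime_factors d. (\<omega> p / p) / (1 - \<omega> p / p))"
        by (rule sieve_g_prod_primes[OF mult]) auto
      then have "sieve_g \<omega> d = (\<Prod>p\<in>prime_factors d. (\<omega> p / p) / (1 - \<omega> p / p))"
        using prod_prime_factors_squarefree[OF that] by simp
      also have "\<dots> \<ge> 0"
        proof (rule prod_nonneg)
          fix p assume "p \<in> prime_factors d"
          then have "0 \<le> \<omega> p / p" "0 < 1 - \<omega> p / p"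
            using x[of p] by (auto simp only: in_prime_factors_iff diff_gt_0_iff_gt)
          then show "0 \<le> (\<omega> p / p) / (1 - \<omega> p / p)" by (rule divide_nonneg_pos)
        qed
      finally show ?thesis .
    qed
    then show "0 \<le> ?F d"
      by (cases "squarefree d") (auto simp: moebius_mu_def)
  qed
  finally show ?thesis by (simp add: sieve_G_def)
qed

section \<open>Rankin's trick and the inequality behind its majorant\<close>

text \<open>For \<open>\<Prod>A \<ge> y\<close> the factor
  \<open>(\<Prod>A / y) powr \<epsilon>\<close> is at least 1. Inserting it and then summing over
  all subsets gives an Euler product, whose factor at \<open>p\<close> times \<open>1 - x p\<close>
  is \<open>1 + x p * (p powr \<epsilon> - 1)\<close>.\<close>

lemma rankin_bound:
  fixes x :: "nat \<Rightarrow> real"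
  assumes "finite P" and pos: "\<And>p. p \<in> P \<Longrightarrow> 0 < p"
    and x: "\<And>p. p \<in> P \<Longrightarrow> 0 \<le> x p \<and> x p < 1" and "0 \<le> \<epsilon>" "0 < y"
  shows "(\<Prod>p\<in>P. 1 - x p) * (\<Sum>A | A \<subseteq> P \<and> y \<le> real (\<Prod>A). \<Prod>p\<in>A. x p / (1 - x p))
    \<le> y powr - \<epsilon> * (\<Prod>p\<in>P. 1 + x p * (p powr \<epsilon> - 1))"
proof -
  let ?\<gamma> = "\<lambda>p. x p / (1 - x p)"
  have \<gamma>: "0 \<le> ?\<gamma> p" if "p \<in> P" for p using x[OF that] by simp
  have "(\<Sum>A | A \<subseteq> P \<and> y \<le> real (\<Prod>A). prod ?\<gamma> A)
      \<le> (\<Sum>A | A \<subseteq> P \<and> y \<le> real (\<Prod>A). y powr - \<epsilon> * (\<Prod>p\<in>A. ?\<gamma> p * p powr \<epsilon>))"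
  proof (rule sum_mono)
    fix A assume A: "A \<in> {A. A \<subseteq> P \<and> y \<le> real (\<Prod>A)}"
    have "(\<Prod>p\<in>A. real p powr \<epsilon>) = real (\<Prod>A) powr \<epsilon>"
      using prod_powr_distrib[of real A \<epsilon>] by simp
    moreover have "1 \<le> y powr - \<epsilon> * real (\<Prod>A) powr \<epsilon>"
      using A \<open>0 \<le> \<epsilon>\<close> \<open>0 < y\<close> powr_mono2[of \<epsilon> y "real (\<Prod>A)"]
      by (simp add: powr_minus field_simps)
    moreover have "0 \<le> prod ?\<gamma> A"
      using A \<gamma> by (intro prod_nonneg) auto
    ultimately have "prod ?\<gamma> A * 1 \<le> prod ?\<gamma> A * (y powr - \<epsilon> * (\<Prod>p\<in>A. real p powr \<epsilon>))"
      by (intro mult_left_mono) simp_all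
    then show "prod ?\<gamma> A \<le> y powr - \<epsilon> * (\<Prod>p\<in>A. ?\<gamma> p * p powr \<epsilon>)"
      unfolding prod.distrib by (simp only: mult_1_right mult.left_commute)
  qed
  also have "\<dots> \<le> (\<Sum>A\<in>Pow P. y powr - \<epsilon> * (\<Prod>p\<in>A. ?\<gamma> p * p powr \<epsilon>))"
    using \<open>finite P\<close> \<gamma> by (intro sum_mono2 mult_nonneg_nonneg prod_nonneg) auto
  also have "\<dots> = y powr - \<epsilon> * (\<Prod>p\<in>P. ?\<gamma> p * p powr \<epsilon> + 1)"
    using \<open>finite P\<close> by (simp add: prod_add sum_distrib_left)
  finally have "(\<Prod>p\<in>P. 1 - x p) * (\<Sum>A | A \<subseteq> P \<and> y \<le> real (\<Prod>A). prod ?\<gamma> A)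
      \<le> (\<Prod>p\<in>P. 1 - x p) * (y powr - \<epsilon> * (\<Prod>p\<in>P. ?\<gamma> p * p powr \<epsilon> + 1))"
    using x by (intro mult_left_mono prod_nonneg) (auto simp: less_imp_le)
  also have "\<dots> = y powr - \<epsilon> * (\<Prod>p\<in>P. (1 - x p) * (?\<gamma> p * p powr \<epsilon> + 1))"
    by (simp add: prod.distrib)
  also have "(\<Prod>p\<in>P. (1 - x p) * (?\<gamma> p * p powr \<epsilon> + 1)) = (\<Prod>p\<in>P. 1 + x p * (p powr \<epsilon> - 1))"
    by (intro prod.cong refl) (use x in \<open>force simp: field_simps\<close>)
  finally show ?thesis .
qed

text \<open>For \<open>s > 0\<close> this says that the derivative of
  \<open>2 * (exp s - 1) / s\<close> majorizes \<open>(exp s - 1) / s\<close>.\<close>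

lemma exp_times_add_nonneg:
  fixes s :: real
  assumes "0 \<le> s"
  shows "0 \<le> s * exp s - 2 * exp s + s + 2"
proof -
  let ?f = "\<lambda>s::real. s * exp s - 2 * exp s + s + 2"
  have "?f 0 \<le> ?f s"
  proof (rule DERIV_nonneg_imp_nondecreasing[OF assms])
    fix t :: real
    have "(?f has_real_derivative exp t * (exp (- t) - (1 - t))) (at t)"
      by (auto intro!: derivative_eq_intros simp: algebra_simps exp_minus_inverse)
    moreover have "1 - t \<le> exp (- t)"
      using exp_ge_add_one_self[of "- t"] by simp
    ultimately show "\<exists>y. (?f has_real_derivative y) (at t) \<and> 0 \<le> y"
      by (intro exI[of _ "exp t * (exp (- t) - (1 - t))"]) simp
  qed
  then show ?thesis by simp
qed

section \<open>First consequences of the two density conditions\<close>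

locale sieve_dimension =
  fixes \<omega> :: "nat \<Rightarrow> real" and \<kappa> A1 A2 L :: real
  assumes mult: "multiplicative_on_squarefree \<omega>"
    and \<kappa>: "\<kappa> \<ge> 1" and A1: "A1 > 1" and A2: "A2 > 0"
    and omega1: "Omega1 \<omega> A1" and omega2: "Omega2 \<omega> \<kappa> A2 L"
begin

lemma density_bounds:
  assumes "prime p"
  shows "0 \<le> \<omega> p / real p" "\<omega> p / real p \<le> 1 - 1 / A1" "\<omega> p / real p < 1"
proof -
  show *: "0 \<le> \<omega> p / real p" "\<omega> p / real p \<le> 1 - 1 / A1"
    using omega1 assms by (auto simp only: Omega1_def)
  have "0 < 1 / A1" using A1 by simp
  with * show "\<omega> p / real p < 1" by linarith
qed

lemma log_weight_nonneg: "prime p \<Longrightarrow> 0 \<le> \<omega> p * ln (real p) / real p"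
  using mult_nonneg_nonneg[OF density_bounds(1), of p "ln (real p)"] prime_ge_1_nat[of p] by simp

text \<open>The lower bound in \<open>Omega2\<close> is applied from 5/2 to 3, a range without
  primes. The sign allows \<open>L / ln 2\<close> to be added to the exponent at the end.\<close>

lemma L_pos: "0 < L"
proof -
  have "\<not> (5/2 \<le> real p \<and> real p < 3)" for p :: nat
  proof
    assume "5/2 \<le> real p \<and> real p < 3"
    then have "2 < p" "p < 3" by linarith+
    then show False by simp
  qed
  then have none: "{p. prime p \<and> 5/2 \<le> real p \<and> real p < 3} = {}" by blast
  have "- L \<le> - (\<kappa> * ln (3 / (5/2)))"
    using omega2[unfolded Omega2_def, rule_format, of "5/2" 3, unfolded none] by simp
  then have "- L \<le> - (\<kappa> * ln (6/5))" by simp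
  moreover have "0 < \<kappa> * ln (6/5::real)" using \<kappa> by simp
  ultimately show ?thesis by linarith
qed

text \<open>The upper half of \<open>Omega2\<close>, extended to the empty range
  \<open>w = z\<close>, which occurs at the endpoints of partial summation.\<close>

lemma log_sum_le:
  assumes "2 \<le> w" "w \<le> z"
  shows "(\<Sum>p | prime p \<and> w \<le> real p \<and> real p < z. \<omega> p * ln (real p) / real p)
    \<le> \<kappa> * (ln z - ln w) + A2"
proof (cases "w = z")
  case True
  then have "{p. prime p \<and> w \<le> real p \<and> real p < z} = {}" by auto
  then show ?thesis using True A2 by (simp only: sum.empty) simp
next
  case False
  then have "w < z" using assms by simp
  have "ln (z / w) = ln z - ln w" using assms by (simp add: ln_div)
  then show ?thesis
    using omega2[unfolded Omega2_def, rule_format, OF \<open>2 \<le> w\<close> \<open>w < z\<close>] by simp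
qed

text \<open>An interval starting at \<open>p\<close> contains the term of \<open>p\<close>, and it
  can be shrunk until only \<open>A2\<close> remains of the upper bound.\<close>

lemma log_weight_le:
  assumes "prime p"
  shows "\<omega> p * ln (real p) / real p \<le> A2"
proof (rule field_le_epsilon)
  fix e :: real assume "0 < e"
  \<comment> \<open>With this endpoint the main term of \<open>log_sum_le\<close> is exactly
    \<open>e\<close>.\<close>
  let ?z = "real p * exp (e / \<kappa>)"
  have p: "2 \<le> real p" using prime_ge_2_nat[OF assms] by simp
  have "0 < e / \<kappa>" using \<open>0 < e\<close> \<kappa> by simp
  then have z: "real p < ?z" using p by simp
  let ?P = "{q. prime q \<and> real p \<le> real q \<and> real q < ?z}"
  have "finite ?P" by (rule finite_subset[OF _ finite_primes_below[of ?z]]) auto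
  then have "\<omega> p * ln (real p) / real p \<le> (\<Sum>q\<in>?P. \<omega> q * ln (real q) / real q)"
    by (intro member_le_sum[where f = "\<lambda>q. \<omega> q * ln (real q) / real q"] log_weight_nonneg)
      (use assms z in auto)
  also have "\<dots> \<le> \<kappa> * (ln ?z - ln (real p)) + A2"
    using p z by (intro log_sum_le) auto
  also have "ln ?z - ln (real p) = e / \<kappa>" using p by (simp add: ln_mult)
  also have "\<kappa> * (e / \<kappa>) + A2 = A2 + e" using \<kappa> by simp
  finally show "\<omega> p * ln (real p) / real p \<le> A2 + e" .
qed

section \<open>The defect of \<open>G\<close> times \<open>W\<close>\<close>

text \<open>Partial summation with weights \<open>\<omega> p * ln p / p\<close> at the points
  \<open>ln p\<close> and \<open>h t = (exp (\<epsilon> * t) - 1) / t\<close>. The 2 in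
  \<open>2 * \<kappa> / l\<close> is the cost of the majorant \<open>H'\<close>.\<close>

lemma shifted_sum_le:
  assumes "2 \<le> w" "0 < l"
  shows "(\<Sum>p | prime p \<and> real p < w. \<omega> p / p * (p powr (l / ln w) - 1))
    \<le> (2 * \<kappa> / l + A2 / ln w) * exp l"
proof -
  define \<epsilon> where "\<epsilon> = l / ln w"
  define h where "h t = (exp (\<epsilon> * t) - 1) / t" for t
  define H where "H t = 2 * (exp (\<epsilon> * t) - 1) / (\<epsilon> * t)" for t
  let ?P = "{p. prime p \<and> real p < w}"
  let ?a = "\<lambda>p. \<omega> p * ln (real p) / real p"
  let ?N = "\<lambda>t. (\<epsilon> * t) * exp (\<epsilon> * t) - exp (\<epsilon> * t) + 1"
  have lnw: "0 < ln w" using assms by simp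
  then have \<epsilon>: "0 < \<epsilon>" using assms by (simp add: \<epsilon>_def)
  have ln2: "0 < ln (2::real)" by simp
  have fin: "finite ?P" by (rule finite_primes_below)
  have ge2: "2 \<le> real p" if "prime p" for p using prime_ge_2_nat[OF that] by simp
  have "(\<Sum>p\<in>?P. ?a p * h (ln (real p))) \<le> A2 * h (ln w) + \<kappa> * (H (ln w) - H (ln 2))"
  proof (rule weighted_sum_le_increasing[where h' = "\<lambda>t. ?N t / t\<^sup>2" and H' = "\<lambda>t. 2 * ?N t / (\<epsilon> * t\<^sup>2)"])
    show "ln 2 \<le> ln w" "0 \<le> \<kappa>" using assms \<kappa> by auto
    show "ln (real p) \<in> {ln 2..ln w}" if "p \<in> ?P" for p
      using that ge2[of p] by (auto intro: ln_mono)
    have "?P = {p. prime p \<and> 2 \<le> real p \<and> real p < w}" using ge2 by auto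
    then show "sum ?a ?P \<le> \<kappa> * (ln w - ln 2) + A2"
      using log_sum_le[of 2 w] assms by simp
    have "0 \<le> exp (\<epsilon> * ln 2) - 1" using \<epsilon> by simp
    then show "0 \<le> h (ln 2)" by (simp add: h_def)
    fix t assume t: "t \<in> {ln 2..ln w}"
    then have "0 < t" using ln2 by (simp only: atLeastAtMost_iff) linarith
    have "exp t \<le> w" using t assms by (simp add: ln_ge_iff)
    have "2 \<le> exp t" using t ln_le_cancel_iff[of 2 "exp t"] by simp
    \<comment> \<open>The strict tail is enlarged to a half-open interval, the shape that
      \<open>Omega2\<close> controls.\<close>
    have "sum ?a {p \<in> ?P. t < ln (real p)} \<le> sum ?a {p. prime p \<and> exp t \<le> real p \<and> real p < w}"
    proof (rule sum_mono2)
      show "finite {p. prime p \<and> exp t \<le> real p \<and> real p < w}"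
        by (rule finite_subset[OF _ fin]) auto
      show "{p \<in> ?P. t < ln (real p)} \<subseteq> {p. prime p \<and> exp t \<le> real p \<and> real p < w}"
      proof safe
        fix p assume "prime p" "t < ln (real p)"
        then show "exp t \<le> real p" using ge2[of p] by (simp add: less_imp_le flip: ln_ge_iff)
      qed
    qed (auto intro: log_weight_nonneg)
    also have "\<dots> \<le> \<kappa> * (ln w - t) + A2"
      using log_sum_le[OF \<open>2 \<le> exp t\<close> \<open>exp t \<le> w\<close>] by simp
    finally show "sum ?a {p \<in> ?P. t < ln (real p)} \<le> \<kappa> * (ln w - t) + A2" .
    show "(h has_real_derivative ?N t / t\<^sup>2) (at t)"
      unfolding h_def using \<open>0 < t\<close>
      by (auto intro!: derivative_eq_intros simp: power2_eq_square field_simps)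
    show "(H has_real_derivative 2 * ?N t / (\<epsilon> * t\<^sup>2)) (at t)"
      unfolding H_def using \<open>0 < t\<close> \<epsilon>
      by (auto intro!: derivative_eq_intros simp: power2_eq_square field_simps)
    \<comment> \<open>Monotonicity of \<open>h\<close> amounts to
      \<open>1 - s \<le> exp (- s)\<close> at \<open>s = \<epsilon> * t\<close>, multiplied by
      \<open>exp s\<close>.\<close>
    have "1 - \<epsilon> * t \<le> exp (- (\<epsilon> * t))" using exp_ge_add_one_self[of "- (\<epsilon> * t)"] by simp
    then have "exp (\<epsilon> * t) * (1 - \<epsilon> * t) \<le> exp (\<epsilon> * t) * exp (- (\<epsilon> * t))"
      by (intro mult_left_mono) auto
    then show "0 \<le> ?N t / t\<^sup>2" by (simp add: exp_minus_inverse algebra_simps)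
    have "0 \<le> (\<epsilon> * t) * exp (\<epsilon> * t) - 2 * exp (\<epsilon> * t) + \<epsilon> * t + 2"
      using \<open>0 < t\<close> \<epsilon> by (intro exp_times_add_nonneg) simp
    then have "(\<epsilon> * t) * (exp (\<epsilon> * t) - 1) \<le> 2 * ?N t" by (simp add: algebra_simps)
    then have "(\<epsilon> * t) * (exp (\<epsilon> * t) - 1) / (\<epsilon> * t\<^sup>2) \<le> 2 * ?N t / (\<epsilon> * t\<^sup>2)"
      using \<epsilon> by (intro divide_right_mono) simp_all
    moreover have "h t = (\<epsilon> * t) * (exp (\<epsilon> * t) - 1) / (\<epsilon> * t\<^sup>2)"
      unfolding h_def using \<open>0 < t\<close> \<epsilon> by (simp add: power2_eq_square)
    ultimately show "h t \<le> 2 * ?N t / (\<epsilon> * t\<^sup>2)" by (simp only:)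
  qed (rule fin)
  \<comment> \<open>Since \<open>\<epsilon> * ln w = l\<close>, the values at \<open>ln w\<close>
    are explicit; the \<open>- 1\<close> in each and the nonnegative \<open>H (ln 2)\<close> are
    dropped.\<close>
  also have "\<dots> \<le> A2 * (exp l / ln w) + \<kappa> * (2 * exp l / l)"
  proof (intro add_mono mult_left_mono)
    have eq: "\<epsilon> * ln w = l" using lnw by (simp add: \<epsilon>_def)
    show "h (ln w) \<le> exp l / ln w"
      unfolding h_def eq using lnw by (intro divide_right_mono) simp_all
    have "H (ln w) \<le> 2 * exp l / l"
      unfolding H_def eq using assms by (intro divide_right_mono) simp_all
    moreover have "0 \<le> H (ln 2)"
      unfolding H_def using \<epsilon> by (intro divide_nonneg_nonneg mult_nonneg_nonneg) simp_all
    ultimately show "H (ln w) - H (ln 2) \<le> 2 * exp l / l" by linarith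
  qed (use \<kappa> A2 in auto)
  also have "\<dots> = (2 * \<kappa> / l + A2 / ln w) * exp l" by (simp add: algebra_simps)
  also have "(\<Sum>p\<in>?P. ?a p * h (ln (real p))) = (\<Sum>p\<in>?P. \<omega> p / p * (p powr (l / ln w) - 1))"
  proof (intro sum.cong refl)
    fix p assume "p \<in> ?P"
    then have "0 < ln (real p)" "0 < p" using ge2[of p] by auto
    then show "?a p * h (ln (real p)) = \<omega> p / p * (p powr (l / ln w) - 1)"
      by (simp add: h_def powr_def \<epsilon>_def)
  qed
  finally show ?thesis .
qed

lemma sieve_W_pos: "0 < sieve_W \<omega> z"
  unfolding sieve_W_def by (intro prod_pos) (simp add: density_bounds(3))

text \<open>The term \<open>d = 1\<close> suffices; it comes from the empty set of primes.\<close>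

lemma sieve_G_ge_1:
  assumes "1 < z"
  shows "1 \<le> sieve_G \<omega> z"
proof -
  have "{A::nat set. A \<subseteq> {} \<and> real (\<Prod>A) < z} = {{}}" using assms by auto
  then show ?thesis
    using sieve_G_ge_sum_subsets[OF mult, of "{}" z] density_bounds by simp
qed

text \<open>Keeping \<open>w\<close> and \<open>z\<close> independent allows two uses:
  \<open>w = z\<close> with free \<open>l\<close> for the final defect, and a smaller power of
  \<open>z\<close> with \<open>l = 1\<close> for the constant 1/2.\<close>

lemma sieve_G_mult_W_ge:
  assumes "2 \<le> w" "0 < z" "0 < l"
  shows "1 - exp (- l * (ln z / ln w) + (2 * \<kappa> / l + A2 / ln w) * exp l) \<le> sieve_G \<omega> z * sieve_W \<omega> w"
proof -
  let ?P = "{p::nat. prime p \<and> real p < w}"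
  let ?x = "\<lambda>p. \<omega> p / real p"
  let ?\<gamma> = "\<lambda>A. \<Prod>p\<in>A. ?x p / (1 - ?x p)"
  let ?small = "{A. A \<subseteq> ?P \<and> real (\<Prod>A) < z}" and ?large = "{A. A \<subseteq> ?P \<and> z \<le> real (\<Prod>A)}"
  let ?\<epsilon> = "l / ln w"
  have lnw: "0 < ln w" using assms by simp
  have fin: "finite ?P" by (rule finite_primes_below)
  have W: "sieve_W \<omega> w = (\<Prod>p\<in>?P. 1 - ?x p)" by (simp add: sieve_W_def)
  \<comment> \<open>Subsets of \<open>?P\<close> are split by the size of their product: the small
    ones are bounded by \<open>sieve_G\<close>, the large ones by Rankin's trick.\<close>
  have "sum ?\<gamma> ?small + sum ?\<gamma> ?large = sum ?\<gamma> (?small \<union> ?large)"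
    using fin by (intro sum.union_disjoint[symmetric]) auto
  also have "?small \<union> ?large = Pow ?P" by auto
  also have "sum ?\<gamma> (Pow ?P) = (\<Prod>p\<in>?P. ?x p / (1 - ?x p) + 1)"
    using fin by (simp add: prod_add)
  finally have "sieve_W \<omega> w * (sum ?\<gamma> ?small + sum ?\<gamma> ?large)
      = (\<Prod>p\<in>?P. (1 - ?x p) * (?x p / (1 - ?x p) + 1))"
    by (simp only: W prod.distrib)
  also have "\<dots> = 1"
  proof (rule prod.neutral, rule ballI)
    fix p assume "p \<in> ?P"
    then have "1 - ?x p \<noteq> 0" using density_bounds(3)[of p] by auto
    then show "(1 - ?x p) * (?x p / (1 - ?x p) + 1) = 1" by (simp only: distrib_left) simp
  qed
  finally have total: "sieve_W \<omega> w * (sum ?\<gamma> ?small + sum ?\<gamma> ?large) = 1" .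
  have "sieve_W \<omega> w * sum ?\<gamma> ?large \<le> z powr - ?\<epsilon> * (\<Prod>p\<in>?P. 1 + ?x p * (p powr ?\<epsilon> - 1))"
    unfolding W using assms lnw fin density_bounds
    by (intro rankin_bound) (auto dest: prime_gt_0_nat simp del: divide_less_eq_1 zero_le_divide_iff)
  also have "\<dots> \<le> z powr - ?\<epsilon> * (\<Prod>p\<in>?P. exp (?x p * (p powr ?\<epsilon> - 1)))"
  proof (intro mult_left_mono prod_mono conjI)
    fix p assume "p \<in> ?P"
    then have "1 \<le> real p powr ?\<epsilon>" "0 \<le> ?x p"
      using assms lnw prime_ge_1_nat[of p] density_bounds(1) by (auto intro!: ge_one_powr_ge_zero)
    then have "0 \<le> ?x p * (p powr ?\<epsilon> - 1)" by (intro mult_nonneg_nonneg) simp_all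
    then show "0 \<le> 1 + ?x p * (p powr ?\<epsilon> - 1)" by linarith
    show "1 + ?x p * (p powr ?\<epsilon> - 1) \<le> exp (?x p * (p powr ?\<epsilon> - 1))"
      by (rule exp_ge_add_one_self)
  qed simp
  also have "z powr - ?\<epsilon> = exp (- l * (ln z / ln w))"
    using assms by (simp add: powr_def)
  also have "exp (- l * (ln z / ln w)) * (\<Prod>p\<in>?P. exp (?x p * (p powr ?\<epsilon> - 1)))
      = exp (- l * (ln z / ln w) + (\<Sum>p\<in>?P. ?x p * (p powr ?\<epsilon> - 1)))"
    by (simp only: exp_add exp_sum[OF fin])
  also have "\<dots> \<le> exp (- l * (ln z / ln w) + (2 * \<kappa> / l + A2 / ln w) * exp l)"
    using shifted_sum_le[OF assms(1,3)] by simp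
  finally have "sieve_W \<omega> w * sum ?\<gamma> ?large \<le> \<dots>" .
  moreover have "sum ?\<gamma> ?small * sieve_W \<omega> w \<le> sieve_G \<omega> z * sieve_W \<omega> w"
    using fin density_bounds sieve_W_pos[of w]
    by (intro mult_right_mono sieve_G_ge_sum_subsets[OF mult])
      (auto simp: less_imp_le simp del: divide_less_eq_1 zero_le_divide_iff)
  ultimately show ?thesis using total by (simp add: algebra_simps)
qed

section \<open>The ratio of \<open>W\<close> at \<open>w\<close> to \<open>W\<close> at
  \<open>z\<close>\<close>

lemma log_weighted_sum_le:
  fixes h h' H :: "real \<Rightarrow> real"
  assumes "2 \<le> w" "w \<le> z"
    and h: "\<And>t. t \<in> {ln w..ln z} \<Longrightarrow> (h has_real_derivative h' t) (at t)"
    and H: "\<And>t. t \<in> {ln w..ln z} \<Longrightarrow> (H has_real_derivative h t) (at t)"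
    and h'_nonpos: "\<And>t. t \<in> {ln w..ln z} \<Longrightarrow> h' t \<le> 0"
    and "0 \<le> h (ln z)"
  shows "(\<Sum>p | prime p \<and> w \<le> real p \<and> real p < z. \<omega> p * ln (real p) / real p * h (ln (real p)))
    \<le> A2 * h (ln w) + \<kappa> * (H (ln z) - H (ln w))"
proof (rule weighted_sum_le_decreasing[where x = "\<lambda>p. ln (real p)" and h' = h'])
  let ?P = "{p. prime p \<and> w \<le> real p \<and> real p < z}"
  let ?a = "\<lambda>p. \<omega> p * ln (real p) / real p"
  have fin: "finite {p. prime p \<and> w \<le> real p \<and> real p < y}" for y
    by (rule finite_subset[OF _ finite_primes_below[of y]]) auto
  show "finite ?P" by (rule fin)
  show "ln w \<le> ln z" "0 \<le> \<kappa>" using assms(1,2) \<kappa> by auto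
  show "ln (real p) \<in> {ln w..ln z}" if "p \<in> ?P" for p
    using that assms(1,2) by (auto intro: ln_mono)
  show "sum ?a {p \<in> ?P. ln (real p) < t} \<le> \<kappa> * (t - ln w) + A2" if t: "t \<in> {ln w..ln z}" for t
  proof -
    have "w \<le> exp t" using t assms(1,2) ln_le_cancel_iff[of w "exp t"] by simp
    have "sum ?a {p \<in> ?P. ln (real p) < t} \<le> sum ?a {p. prime p \<and> w \<le> real p \<and> real p < exp t}"
    proof (rule sum_mono2)
      show "{p \<in> ?P. ln (real p) < t} \<subseteq> {p. prime p \<and> w \<le> real p \<and> real p < exp t}"
      proof safe
        fix p :: nat assume "prime p" "ln (real p) < t"
        then show "real p < exp t"
          using prime_gt_0_nat[of p] ln_less_cancel_iff[of "real p" "exp t"] by simp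
      qed
    qed (auto intro: log_weight_nonneg fin)
    also have "\<dots> \<le> \<kappa> * (t - ln w) + A2"
      using log_sum_le[OF \<open>2 \<le> w\<close> \<open>w \<le> exp t\<close>] by simp
    finally show ?thesis .
  qed
  show "(h has_real_derivative h' t) (at t)" "(H has_real_derivative h t) (at t)" "h' t \<le> 0"
    if "t \<in> {ln w..ln z}" for t
    using that by (rule h, rule H, rule h'_nonpos)
qed (rule log_sum_le[OF assms(1,2)], rule assms(6))

text \<open>The weight \<open>1 / ln p\<close> cancels the logarithm in \<open>Omega2\<close>; its
  antiderivative in \<open>t = ln p\<close> is \<open>ln\<close>, hence the iterated
  logarithms.\<close>

lemma density_sum_le:
  assumes "2 \<le> w" "w \<le> z"
  shows "(\<Sum>p | prime p \<and> w \<le> real p \<and> real p < z. \<omega> p / p)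
    \<le> A2 / ln w + \<kappa> * (ln (ln z) - ln (ln w))"
proof -
  have pos: "0 < t" if "t \<in> {ln w..ln z}" for t
  proof -
    have "0 < ln w" using assms by simp
    with that show ?thesis by (simp only: atLeastAtMost_iff) linarith
  qed
  have "(\<Sum>p | prime p \<and> w \<le> real p \<and> real p < z. \<omega> p / p) =
      (\<Sum>p | prime p \<and> w \<le> real p \<and> real p < z. \<omega> p * ln (real p) / real p * (1 / ln (real p)))"
    using assms by (intro sum.cong refl) simp
  also have "\<dots> \<le> A2 * (1 / ln w) + \<kappa> * (ln (ln z) - ln (ln w))"
    using assms
  proof (rule log_weighted_sum_le[where h = "\<lambda>t. 1 / t" and h' = "\<lambda>t. - 1 / t\<^sup>2" and H = ln])
    fix t assume "t \<in> {ln w..ln z}"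
    note t = pos[OF this]
    show "((\<lambda>t. 1 / t) has_real_derivative - 1 / t\<^sup>2) (at t)"
      using t by (auto intro!: derivative_eq_intros simp: power2_eq_square)
    show "(ln has_real_derivative 1 / t) (at t)"
      using t by (auto intro!: derivative_eq_intros)
  qed (use assms in auto)
  finally show ?thesis by simp
qed

text \<open>One factor \<open>\<omega> p / p\<close> is at most \<open>A2 / ln p\<close> by
  \<open>log_weight_le\<close>. What remains is partial summation with \<open>1 / t\<^sup>2\<close>,
  whose antiderivative is \<open>- 1 / t\<close>.\<close>

lemma density_square_sum_le:
  assumes "2 \<le> w" "w \<le> z"
  shows "(\<Sum>p | prime p \<and> w \<le> real p \<and> real p < z. (\<omega> p / p)\<^sup>2)
    \<le> A2 * (A2 / (ln w)\<^sup>2 + \<kappa> / ln w)"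
proof -
  have pos: "0 < t" if "t \<in> {ln w..ln z}" for t
  proof -
    have "0 < ln w" using assms by simp
    with that show ?thesis by (simp only: atLeastAtMost_iff) linarith
  qed
  have "(\<Sum>p | prime p \<and> w \<le> real p \<and> real p < z. (\<omega> p / p)\<^sup>2) \<le>
      (\<Sum>p | prime p \<and> w \<le> real p \<and> real p < z.
        A2 * (\<omega> p * ln (real p) / real p * (1 / (ln (real p))\<^sup>2)))"
  proof (rule sum_mono)
    fix p assume p: "p \<in> {p. prime p \<and> w \<le> real p \<and> real p < z}"
    let ?b = "\<omega> p * ln (real p) / real p * (1 / (ln (real p))\<^sup>2)"
    have lnp: "0 < ln (real p)" using p assms by simp
    have "(\<omega> p / p)\<^sup>2 = \<omega> p * ln (real p) / real p * ?b"
      using lnp by (simp add: power2_eq_square)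
    also have "\<dots> \<le> A2 * ?b"
      using p log_weight_le[of p] log_weight_nonneg[of p]
      by (intro mult_right_mono mult_nonneg_nonneg) auto
    finally show "(\<omega> p / p)\<^sup>2 \<le> A2 * ?b" .
  qed
  also have "\<dots> \<le> A2 * (A2 * (1 / (ln w)\<^sup>2) + \<kappa> * (- 1 / ln z - - 1 / ln w))"
    unfolding sum_distrib_left[symmetric]
  proof (rule mult_left_mono[OF log_weighted_sum_le[OF assms, where h = "\<lambda>t. 1 / t\<^sup>2"
          and h' = "\<lambda>t. - 2 / t ^ 3" and H = "\<lambda>t. - 1 / t"]])
    fix t assume "t \<in> {ln w..ln z}"
    note t = pos[OF this]
    show "((\<lambda>t. 1 / t\<^sup>2) has_real_derivative - 2 / t ^ 3) (at t)"
      using t by (auto intro!: derivative_eq_intros simp: field_simps power2_eq_square power3_eq_cube)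
    show "((\<lambda>t. - 1 / t) has_real_derivative 1 / t\<^sup>2) (at t)"
      using t by (auto intro!: derivative_eq_intros simp: power2_eq_square)
    show "- 2 / t ^ 3 \<le> 0" using t by simp
  qed (use A2 in auto)
  also have "\<dots> \<le> A2 * (A2 / (ln w)\<^sup>2 + \<kappa> / ln w)"
  proof (intro mult_left_mono)
    have "0 \<le> \<kappa> * (1 / ln z)" using assms \<kappa> by simp
    then show "A2 * (1 / (ln w)\<^sup>2) + \<kappa> * (- 1 / ln z - - 1 / ln w) \<le> A2 / (ln w)\<^sup>2 + \<kappa> / ln w"
      by (simp add: algebra_simps)
  qed (use A2 in auto)
  finally show ?thesis .
qed

text \<open>Each factor satisfies \<open>1 / (1 - x) \<le> exp (x + A1 * x\<^sup>2)\<close>, which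
  reduces the ratio to the two preceding sums. The main term of the first gives the power of
  \<open>ln z / ln w\<close>, all else goes into the constant.\<close>

lemma sieve_W_le:
  assumes "2 \<le> w" "w \<le> z"
  shows "sieve_W \<omega> w \<le> sieve_W \<omega> z *
    ((ln z / ln w) powr \<kappa> * exp (A2 / ln 2 * (1 + A1 * \<kappa> + A1 * A2 / ln 2)))"
proof -
  let ?P = "{p. prime p \<and> w \<le> real p \<and> real p < z}"
  let ?x = "\<lambda>p. \<omega> p / real p"
  let ?Y = "\<Sum>p\<in>?P. ?x p + A1 * (?x p)\<^sup>2"
  have fin: "finite ?P" by (rule finite_subset[OF _ finite_primes_below[of z]]) auto
  have "0 < ln w" "ln 2 \<le> ln w" "ln w \<le> ln z" using assms by auto
  have "sieve_W \<omega> w * (\<Prod>p\<in>?P. 1 - ?x p) = (\<Prod>p\<in>{p. prime p \<and> real p < w} \<union> ?P. 1 - ?x p)"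
    unfolding sieve_W_def using fin finite_primes_below
    by (intro prod.union_disjoint[symmetric]) auto
  also have "{p. prime p \<and> real p < w} \<union> ?P = {p. prime p \<and> real p < z}"
    using assms by auto
  finally have split: "sieve_W \<omega> z = sieve_W \<omega> w * (\<Prod>p\<in>?P. 1 - ?x p)"
    by (simp only: sieve_W_def)
  have "1 \<le> (\<Prod>p\<in>?P. (1 - ?x p) * exp (?x p + A1 * (?x p)\<^sup>2))"
  proof (rule prod_ge_1)
    fix p assume "p \<in> ?P"
    define x where "x = ?x p"
    have x: "x \<le> 1 - 1 / A1" "x < 1" using density_bounds \<open>p \<in> ?P\<close> by (auto simp only: x_def)
    \<comment> \<open>This form of \<open>Omega1\<close> lets
      \<open>A1 * x\<^sup>2 * (1 - x)\<close> absorb the \<open>- x\<^sup>2\<close> in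
      \<open>(1 - x) * (1 + x)\<close>.\<close>
    then have "1 \<le> A1 * (1 - x)" using A1 by (simp add: field_simps)
    then have "x\<^sup>2 * 1 \<le> x\<^sup>2 * (A1 * (1 - x))" by (rule mult_left_mono) simp
    then have "1 \<le> (1 - x) * (1 + (x + A1 * x\<^sup>2))" by (simp add: algebra_simps power2_eq_square)
    also have "\<dots> \<le> (1 - x) * exp (x + A1 * x\<^sup>2)"
      using x exp_ge_add_one_self[of "x + A1 * x\<^sup>2"] by (intro mult_left_mono) simp_all
    finally show "1 \<le> (1 - ?x p) * exp (?x p + A1 * (?x p)\<^sup>2)" by (simp only: x_def)
  qed
  also have "\<dots> = (\<Prod>p\<in>?P. 1 - ?x p) * exp ?Y"
    by (simp only: prod.distrib exp_sum[OF fin])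
  finally have "sieve_W \<omega> w * 1 \<le> sieve_W \<omega> w * ((\<Prod>p\<in>?P. 1 - ?x p) * exp ?Y)"
    using sieve_W_pos[of w] by (intro mult_left_mono) simp_all
  then have "sieve_W \<omega> w \<le> sieve_W \<omega> z * exp ?Y"
    by (simp only: split mult_1_right mult.assoc)
  also have "exp ?Y \<le> exp (\<kappa> * ln (ln z / ln w) + A2 / ln 2 * (1 + A1 * \<kappa> + A1 * A2 / ln 2))"
  proof -
    have "?Y = (\<Sum>p\<in>?P. ?x p) + A1 * (\<Sum>p\<in>?P. (?x p)\<^sup>2)"
      by (simp add: sum.distrib sum_distrib_left)
    also have "\<dots> \<le> (A2 / ln w + \<kappa> * (ln (ln z) - ln (ln w)))
        + A1 * (A2 * (A2 / (ln w)\<^sup>2 + \<kappa> / ln w))"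
      using A1 by (intro add_mono mult_left_mono density_sum_le density_square_sum_le assms) simp
    \<comment> \<open>Replacing \<open>ln w\<close> by \<open>ln 2\<close> in the error terms makes
      the constant independent of \<open>w\<close>.\<close>
    also have "\<dots> \<le> (A2 / ln 2 + \<kappa> * (ln (ln z) - ln (ln w)))
        + A1 * (A2 * (A2 / (ln 2)\<^sup>2 + \<kappa> / ln 2))"
      using A1 A2 \<kappa> \<open>ln 2 \<le> ln w\<close> \<open>0 < ln w\<close>
      by (intro add_mono mult_left_mono divide_left_mono power_mono order_refl mult_pos_pos
          zero_less_power) auto
    also have "ln (ln z) - ln (ln w) = ln (ln z / ln w)"
      using \<open>0 < ln w\<close> \<open>ln w \<le> ln z\<close> by (simp add: ln_div)
    finally show ?thesis by (simp add: algebra_simps power2_eq_square)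
  qed
  also have "\<dots> = (ln z / ln w) powr \<kappa> * exp (A2 / ln 2 * (1 + A1 * \<kappa> + A1 * A2 / ln 2))"
    using \<open>0 < ln w\<close> \<open>ln w \<le> ln z\<close> by (simp add: powr_def exp_add)
  finally show ?thesis using sieve_W_pos[of z] by simp
qed

section \<open>The lower bound for \<open>G\<close> times \<open>W\<close> and the theorem\<close>

text \<open>At \<open>w = z powr (1 / m4)\<close> the choice \<open>l = 1\<close> leaves a defect of
  at most 1/2; \<open>sieve_W_le\<close> then carries the bound from \<open>w\<close> to
  \<open>z\<close>.\<close>

lemma sieve_G_mult_W_ge_half:
  assumes "2 < z"
  shows "1 / 2 \<le> sieve_G \<omega> z * (sieve_W \<omega> z *
    (m4 \<kappa> A2 powr \<kappa> * exp (A2 / ln 2 * (1 + A1 * \<kappa> + A1 * A2 / ln 2))))"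
proof -
  let ?B = "A2 / ln 2 * (1 + A1 * \<kappa> + A1 * A2 / ln 2)"
  define u where "u = m4 \<kappa> A2"
  \<comment> \<open>The cut at 2 is there because \<open>Omega2\<close> controls prime sums only
    from 2 on.\<close>
  define w where "w = max 2 (z powr (1 / u))"
  have "1 * 1 \<le> 2 * \<kappa> * exp 1" using \<kappa> by (intro mult_mono) simp_all
  moreover have "0 \<le> A2 * exp 1 / ln 2" using A2 by simp
  ultimately have u: "1 \<le> u" unfolding u_def m4_def by (smt (verit) ln_gt_zero)
  have "z powr (1 / u) \<le> z powr 1" using u assms by (intro powr_mono) auto
  then have w: "2 \<le> w" "w \<le> z" using assms by (auto simp: w_def)
  then have lnw: "0 < ln w" "ln 2 \<le> ln w" by auto
  have "ln (z powr (1 / u)) \<le> ln w"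
    using assms by (intro ln_mono) (auto simp: w_def)
  then have "ln z / ln w \<le> u" using u lnw assms by (simp add: ln_powr field_simps)
  have "1 / 2 \<le> sieve_G \<omega> z * sieve_W \<omega> w"
  proof (cases "z powr (1 / u) \<le> 2")
    \<comment> \<open>No prime lies below 2, so \<open>W\<close> is the empty product and
      \<open>G \<ge> 1\<close> is enough.\<close>
    case True
    then have "w = 2" by (simp add: w_def)
    moreover have "{p::nat. prime p \<and> real p < 2} = {}"
      by (auto dest: prime_ge_2_nat)
    ultimately have "sieve_W \<omega> w = 1" by (simp only: sieve_W_def prod.empty)
    then show ?thesis using sieve_G_ge_1[of z] assms by simp
  next
    case False
    then have "ln w = ln z / u" using assms by (simp add: w_def ln_powr)
    then have "ln z / ln w = u" using assms u by simp
    then have "1 - exp (- u + (2 * \<kappa> + A2 / ln w) * exp 1) \<le> sieve_G \<omega> z * sieve_W \<omega> w"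
      using sieve_G_mult_W_ge[OF w(1), of z 1] assms by simp
    moreover have "A2 / ln w \<le> A2 / ln 2"
      using lnw A2 by (intro divide_left_mono) auto
    then have "(2 * \<kappa> + A2 / ln w) * exp 1 \<le> (2 * \<kappa> + A2 / ln 2) * exp 1"
      by (intro mult_right_mono) simp_all
    \<comment> \<open>The constant \<open>m4\<close> exceeds
      \<open>(2 * \<kappa> + A2 / ln 2) * exp 1\<close> by exactly \<open>ln 2\<close>.\<close>
    then have "- u + (2 * \<kappa> + A2 / ln w) * exp 1 \<le> - ln 2"
      by (simp add: u_def m4_def algebra_simps)
    then have "exp (- u + (2 * \<kappa> + A2 / ln w) * exp 1) \<le> exp (- ln 2)"
      by (simp only: exp_le_cancel_iff)
    then have "exp (- u + (2 * \<kappa> + A2 / ln w) * exp 1) \<le> 1 / 2"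
      by (simp add: exp_minus)
    ultimately show ?thesis by linarith
  qed
  also have "\<dots> \<le> sieve_G \<omega> z * (sieve_W \<omega> z * ((ln z / ln w) powr \<kappa> * exp ?B))"
    using sieve_G_ge_1[of z] assms by (intro mult_left_mono sieve_W_le w) auto
  also have "\<dots> \<le> sieve_G \<omega> z * (sieve_W \<omega> z * (u powr \<kappa> * exp ?B))"
    using sieve_G_ge_1[of z] sieve_W_pos[of z] assms \<open>ln z / ln w \<le> u\<close> lnw \<kappa>
    by (intro mult_left_mono mult_right_mono powr_mono2) auto
  finally show ?thesis by (simp only: u_def)
qed

end

theorem theorem2p7:
  fixes \<omega> :: "nat \<Rightarrow> real" and \<kappa> A1 A2 L z lam :: real
  assumes "multiplicative_on_squarefree \<omega>"
    and "\<kappa> \<ge> 1" and "A1 > 1" and "A2 > 0"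
    and "Omega1 \<omega> A1"
    and "Omega2 \<omega> \<kappa> A2 L"
    and "z > 2" and "lam > 0"
  shows "inverse (sieve_G \<omega> z) \<le> sieve_W \<omega> z * m3 \<kappa> A1 A2 L z lam"
proof -
  interpret sieve_dimension \<omega> \<kappa> A1 A2 L
    using assms by unfold_locales
  let ?GW = "sieve_G \<omega> z * sieve_W \<omega> z"
  define E where "E = - lam + (2 * \<kappa> / lam + A2 / ln z) * exp lam"
  define B where "B = A2 / ln 2 * (1 + A1 * \<kappa> + A1 * A2 / ln 2)"
  define R where "R = m4 \<kappa> A2 powr \<kappa> * exp B"
  have G: "1 \<le> sieve_G \<omega> z" using sieve_G_ge_1[of z] assms by simp
  have GW: "0 \<le> ?GW" using G sieve_W_pos[of z] by simp
  have tail: "1 - exp E \<le> ?GW"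
    using sieve_G_mult_W_ge[of z z lam] assms by (simp add: E_def)
  have half: "1 / 2 \<le> ?GW * R"
    using sieve_G_mult_W_ge_half[of z] assms by (simp only: R_def B_def mult.assoc)
  have "1 + 2 * (R * exp E) = 1 + 2 * m4 \<kappa> A2 powr \<kappa> * exp (B + E)"
    by (simp add: R_def exp_add)
  also have "\<dots> \<le> 1 + 2 * m4 \<kappa> A2 powr \<kappa> * exp (B + L / ln 2 + E)"
    using L_pos by (intro add_left_mono mult_left_mono) simp_all
  also have "\<dots> = m3 \<kappa> A1 A2 L z lam"
    by (simp add: m3_def B_def E_def)
  finally have m3: "1 + 2 * (R * exp E) \<le> m3 \<kappa> A1 A2 L z lam" .
  \<comment> \<open>The defect \<open>exp E\<close> is thereby at most
    \<open>2 * ?GW * R * exp E\<close>, so \<open>1 \<le> ?GW + exp E\<close> becomes a bound by a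
    multiple of \<open>?GW\<close>.\<close>
  have "1 / 2 * exp E \<le> ?GW * R * exp E"
    using half by (rule mult_right_mono) simp
  moreover have "?GW * (1 + 2 * (R * exp E)) = ?GW + 2 * (?GW * R * exp E)"
    by (simp add: algebra_simps)
  ultimately have "1 \<le> ?GW * (1 + 2 * (R * exp E))"
    using tail by linarith
  also have "\<dots> \<le> ?GW * m3 \<kappa> A1 A2 L z lam"
    using m3 GW by (rule mult_left_mono)
  finally show ?thesis using G by (simp add: field_simps)
qed

end
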